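(* There exist absolute constants $c>0$ and $C>0$ such that for all $1\le\sigma\le2$, all $2\le p<\infty$, all integers $N\ge2$ and all complex numbers $a_1,\dots,a_N$, $$\bigg(\int_{[0,1]\times[0,N^{-\sigma}]}\bigg|\sum_{k=1}^N a_k\,e\bigl(x_1k+x_2k^2\bigr)\bigg|^p\,dx\bigg)^{\frac1p}\le C(\log N)^c\bigg(N^{\frac{\sigma}{2}\left(1-\frac4p\right)}+N^{1-\frac4p}\bigg)\bigg(\sum_{k=1}^N|a_k|^p\bigg)^{\frac1p}.$$
   Context: Notation: $e(t):=e^{2\pi i t}$ for $t\in\mathbb R$, and $dx=dx_1\,dx_2$. *)

theory Defs
  imports "HOL-Analysis.Analysis"
begin

definition e :: "real \<Rightarrow> complex" where
  "e t = exp (2 * of_real pi * \<i> * of_real t)"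

definition quad_exp_sum :: "nat \<Rightarrow> (nat \<Rightarrow> complex) \<Rightarrow> real \<times> real \<Rightarrow> complex" where
  "quad_exp_sum N a x = (\<Sum>k=1..N. a k * e (fst x * real k + snd x * (real k)\<^sup>2))"

end

theory Submission
  imports Defs
begin

text \<open>
  Write \<open>f\<close> for the exponential sum and \<open>B = [0,1] \<times> [0, N powr -\<sigma>]\<close>. The bound is what
  interpolation between \<open>p = 2\<close>, \<open>p = 4\<close> and \<open>p = \<infinity>\<close> predicts: as functions of \<open>1/p\<close> both
  exponents of \<open>N\<close> are linear, they agree at \<open>p = 4\<close>, and the term with \<open>\<sigma>/2\<close> dominates
  for \<open>p \<le> 4\<close>, the other one for \<open>p \<ge> 4\<close>. At \<open>p = 2\<close> the estimate is orthogonality in the first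
  variable (\<open>second_moment_le\<close>), and at \<open>p = \<infinity>\<close> it is the triangle inequality.

  The substance is the case \<open>p = 4\<close>, where no power of \<open>N\<close> may be lost: the integral of
  \<open>|f|\<^sup>4\<close> over \<open>B\<close> is \<open>O(ln N)\<close> times the sum of the \<open>|a k|\<^sup>4\<close> (\<open>fourth_moment_le\<close>). Since \<open>\<sigma> \<ge> 1\<close>,
  the box has height at most \<open>1/N\<close>, so it only resolves the quadratic frequencies up to
  an error \<open>N\<close>. Thus \<open>f\<^sup>2\<close> behaves like an orthogonal sum, up to the number of pairs \<open>(k', l')\<close> with
  \<open>k' + l' = k + l\<close> for which \<open>k'\<^sup>2 + l'\<^sup>2\<close> and \<open>k\<^sup>2 + l\<^sup>2\<close> differ by at most \<open>N\<close>. This number is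
  \<open>O(N / (|k - l| + 1))\<close> (\<open>card_same_sum_near_sq_sum_le\<close>), because the difference \<open>k' - l'\<close> is a
  square root of a number known up to \<open>O(N)\<close>. The harmonic sum over \<open>l\<close> produces the logarithm.

  Interpolation is done by hand. If all nonzero \<open>|a k|\<close> are comparable, pointwise inequalities
  between \<open>|f| powr p\<close>, \<open>|f|\<^sup>2\<close> and \<open>|f|\<^sup>4\<close> give the claim (\<open>moment_le_of_bounded_coeffs\<close>). A general
  sequence splits into \<open>O(ln N)\<close> dyadic level sets of this kind, plus a remainder of coefficients
  so small that they are dominated by the largest one (\<open>dyadic_level_sets\<close>); the number of
  pieces only costs further powers of \<open>ln N\<close>.
\<close>

section \<open>Additive characters and almost orthogonality\<close>

lemma e_add: "e (s + t) = e s * e t"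
  by (simp add: e_def exp_add [symmetric] algebra_simps)

lemma norm_e [simp]: "norm (e t) = 1"
proof -
  have "e t = exp (\<i> * of_real (2 * pi * t))"
    by (simp add: e_def mult_ac)
  then show ?thesis
    by (simp only: norm_exp_i_times)
qed

lemma cnj_e: "cnj (e t) = e (- t)"
  by (simp add: e_def exp_cnj)

lemma Re_e: "Re (e t) = cos (2 * pi * t)"
  by (simp add: e_def Re_exp)

lemma continuous_on_e [continuous_intros]:
  "continuous_on S f \<Longrightarrow> continuous_on S (\<lambda>x. e (f x))"
  unfolding e_def by (intro continuous_intros)

lemma continuous_on_quad_exp_sum [continuous_intros]:
  "continuous_on S (quad_exp_sum N a)"
  unfolding quad_exp_sum_def by (intro continuous_intros)

lemma integral_e_eq_0:
  assumes "m \<noteq> 0"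
  shows "integral {0..1} (\<lambda>t. e (real_of_int m * t)) = 0"
proof -
  define z where "z = 2 * of_real pi * \<i> * complex_of_int m"
  have z: "z \<noteq> 0"
    using assms by (simp add: z_def)
  have E: "e (real_of_int m * t) = exp (z * of_real t)" for t
    by (simp add: e_def z_def mult_ac)
  have "((\<lambda>t. exp (z * of_real t)) has_integral
          exp (z * of_real 1) / z - exp (z * of_real 0) / z) {0..1}"
  proof (rule fundamental_theorem_of_calculus)
    fix t :: real
    have "((\<lambda>w. exp (z * w) / z) has_field_derivative (exp (z * of_real t) * (z * 1)) / z)
            (at (complex_of_real t))"
      by (intro DERIV_cdivide DERIV_fun_exp DERIV_cmult DERIV_ident)
    then have D: "((\<lambda>w. exp (z * w) / z) has_field_derivative exp (z * of_real t)) (at (of_real t))"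
      using z by simp
    show "((\<lambda>t. exp (z * of_real t) / z) has_vector_derivative exp (z * of_real t))
            (at t within {0..1})"
      using has_vector_derivative_at_within[OF has_vector_derivative_real_field[OF D]] .
  qed simp
  moreover have "exp (z * of_real 1) = 1"
    using exp_integer_2pi[of "of_int m"] by (simp add: z_def mult_ac)
  ultimately show ?thesis
    by (simp add: E integral_unique)
qed

lemma integral_box_e:
  "integral (cbox (0, 0) (1, h)) (\<lambda>x. e (s * fst x + t * snd x)) =
     integral {0..1} (\<lambda>y. e (s * y)) * integral {0..h} (\<lambda>y. e (t * y))"
proof -
  have "integral (cbox (0, 0) (1, h)) (\<lambda>x. e (s * fst x + t * snd x)) =
        integral (cbox 0 1) (\<lambda>y. integral (cbox 0 h) (\<lambda>w. e (s * y) * e (t * w)))"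
    by (subst integral_prod_continuous) (auto intro!: continuous_intros simp: e_add)
  then show ?thesis
    by simp
qed

text \<open>
  Expanding the square leaves only the pairs \<open>(s, t)\<close> with equal frequency labels
  \<open>\<phi> s = \<phi> t\<close>; on these \<open>|c s c t| \<le> (|c s|\<^sup>2 + |c t|\<^sup>2) / 2\<close>, and by symmetry every \<open>|c s|\<^sup>2\<close> is
  counted as often as its label occurs. With an injective label this is Bessel's inequality;
  for the fourth moment the labels have multiplicities, and bounding them becomes
  a counting problem.
\<close>

lemma integral_norm_sq_sum_le:
  fixes u :: "'s \<Rightarrow> 'a::euclidean_space \<Rightarrow> complex" and c :: "'s \<Rightarrow> complex"
  assumes fin: "finite S"
    and cont: "\<And>s. s \<in> S \<Longrightarrow> continuous_on (cbox v w) (u s)"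
    and bd: "\<And>s x. s \<in> S \<Longrightarrow> norm (u s x) \<le> 1"
    and orth: "\<And>s t. s \<in> S \<Longrightarrow> t \<in> S \<Longrightarrow> \<phi> s \<noteq> \<phi> t \<Longrightarrow>
                 integral (cbox v w) (\<lambda>x. u s x * cnj (u t x)) = 0"
  shows "integral (cbox v w) (\<lambda>x. (norm (\<Sum>s\<in>S. c s * u s x))\<^sup>2) \<le>
           measure lborel (cbox v w) * (\<Sum>s\<in>S. (norm (c s))\<^sup>2 * real (card {t \<in> S. \<phi> t = \<phi> s}))"
proof -
  let ?B = "cbox v w"
  let ?F = "\<lambda>x. \<Sum>s\<in>S. c s * u s x"
  let ?I = "\<lambda>s t. integral ?B (\<lambda>x. u s x * cnj (u t x))"
  have int: "(\<lambda>x. u s x * cnj (u t x)) integrable_on ?B" if "s \<in> S" "t \<in> S" for s t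
    by (intro integrable_continuous continuous_intros cont that)
  have exp: "complex_of_real ((norm (?F x))\<^sup>2) =
      (\<Sum>s\<in>S. \<Sum>t\<in>S. c s * cnj (c t) * (u s x * cnj (u t x)))" for x
    by (simp only: complex_norm_square cnj_sum sum_product complex_cnj_mult mult_ac)
  have "complex_of_real (integral ?B (\<lambda>x. (norm (?F x))\<^sup>2)) =
        integral ?B (\<lambda>x. complex_of_real ((norm (?F x))\<^sup>2))"
    by (subst integral_linear[where h = "of_real :: real \<Rightarrow> complex", unfolded o_def])
       (auto intro!: integrable_continuous continuous_intros cont bounded_linear_of_real)
  also have "\<dots> = (\<Sum>s\<in>S. \<Sum>t\<in>S. c s * cnj (c t) * ?I s t)"
    unfolding exp using fin int
    by (simp add: Henstock_Kurzweil_Integration.integral_sum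
        Henstock_Kurzweil_Integration.integrable_sum integrable_on_mult_right
        Henstock_Kurzweil_Integration.integral_mult_right)
  finally have *: "complex_of_real (integral ?B (\<lambda>x. (norm (?F x))\<^sup>2)) = \<dots>" .
  have "\<bar>integral ?B (\<lambda>x. (norm (?F x))\<^sup>2)\<bar> =
      norm (\<Sum>s\<in>S. \<Sum>t\<in>S. c s * cnj (c t) * ?I s t)"
    unfolding *[symmetric] norm_of_real ..
  also have "\<dots> \<le> (\<Sum>s\<in>S. \<Sum>t\<in>S. (if \<phi> t = \<phi> s then 1 else 0) *
                       (measure lborel ?B * (((norm (c s))\<^sup>2 + (norm (c t))\<^sup>2) / 2)))"
  proof (intro sum_norm_le)
    fix s t assume st: "s \<in> S" "t \<in> S"
    show "norm (c s * cnj (c t) * ?I s t) \<le> (if \<phi> t = \<phi> s then 1 else 0) *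
                       (measure lborel ?B * (((norm (c s))\<^sup>2 + (norm (c t))\<^sup>2) / 2))"
    proof (cases "\<phi> t = \<phi> s")
      case False
      then show ?thesis
        using orth[OF st] by simp
    next
      case True
      have I: "norm (?I s t) \<le> 1 * measure lborel ?B"
        by (rule Henstock_Kurzweil_Integration.integrable_bound[OF _ int[OF st]])
           (use bd st in \<open>auto simp: norm_mult intro!: mult_le_one\<close>)
      have "norm (c s) * norm (c t) \<le> ((norm (c s))\<^sup>2 + (norm (c t))\<^sup>2) / 2"
        using sum_squares_bound[of "norm (c s)" "norm (c t)"] by simp
      then have "norm (c s) * norm (c t) * norm (?I s t) \<le>
             ((norm (c s))\<^sup>2 + (norm (c t))\<^sup>2) / 2 * measure lborel ?B"
        using I by (intro mult_mono) auto
      then show ?thesis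
        using True by (simp add: norm_mult mult_ac)
    qed
  qed
  also have "\<dots> = measure lborel ?B / 2 *
       ((\<Sum>s\<in>S. \<Sum>t\<in>S. (if \<phi> t = \<phi> s then (norm (c s))\<^sup>2 else 0)) +
        (\<Sum>s\<in>S. \<Sum>t\<in>S. (if \<phi> t = \<phi> s then (norm (c t))\<^sup>2 else 0)))"
    unfolding sum_distrib_left sum.distrib[symmetric]
    by (intro sum.cong refl) (auto simp: field_simps)
  also have "(\<Sum>s\<in>S. \<Sum>t\<in>S. (if \<phi> t = \<phi> s then (norm (c t))\<^sup>2 else 0)) =
             (\<Sum>s\<in>S. \<Sum>t\<in>S. (if \<phi> t = \<phi> s then (norm (c s))\<^sup>2 else 0))"
    by (subst sum.swap) (simp add: eq_commute)
  also have "(\<Sum>s\<in>S. \<Sum>t\<in>S. (if \<phi> t = \<phi> s then (norm (c s))\<^sup>2 else 0)) =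
             (\<Sum>s\<in>S. (norm (c s))\<^sup>2 * real (card {t \<in> S. \<phi> t = \<phi> s}))"
    using fin by (simp add: sum.If_cases Int_def mult.commute)
  finally show ?thesis
    by simp
qed

text \<open>
  The linear frequencies \<open>k\<close> are distinct integers, so integrating over a full period in the
  first variable already separates the terms; hence any height \<open>h\<close> is allowed.
\<close>

lemma second_moment_le:
  assumes "0 \<le> h"
  shows "integral (cbox (0, 0) (1, h)) (\<lambda>x. (norm (quad_exp_sum N a x))\<^sup>2)
           \<le> h * (\<Sum>k=1..N. (norm (a k))\<^sup>2)"
proof -
  have "integral (cbox (0, 0) (1, h))
          (\<lambda>x. (norm (\<Sum>k=1..N. a k * e (fst x * real k + snd x * (real k)\<^sup>2)))\<^sup>2)
      \<le> measure lborel (cbox (0::real, 0::real) (1, h)) *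
          (\<Sum>k=1..N. (norm (a k))\<^sup>2 * real (card {t \<in> {1..N}. id t = id k}))"
  proof (rule integral_norm_sq_sum_le)
    fix s t :: nat
    assume "id s \<noteq> id t"
    then have "integral {0..1} (\<lambda>y. e (real_of_int (int s - int t) * y)) = 0"
      by (intro integral_e_eq_0) simp
    moreover have "e (fst x * real s + snd x * (real s)\<^sup>2) * cnj (e (fst x * real t + snd x * (real t)\<^sup>2))
        = e (real_of_int (int s - int t) * fst x + ((real s)\<^sup>2 - (real t)\<^sup>2) * snd x)" for x
      unfolding cnj_e e_add[symmetric] by (simp add: algebra_simps)
    ultimately show "integral (cbox (0, 0) (1, h))
       (\<lambda>x. e (fst x * real s + snd x * (real s)\<^sup>2) * cnj (e (fst x * real t + snd x * (real t)\<^sup>2))) = 0"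
      by (simp only: integral_box_e) simp
  qed (auto intro!: continuous_intros)
  also have "\<dots> = h * (\<Sum>k=1..N. (norm (a k))\<^sup>2 * real (card {k}))"
    using assms by (intro arg_cong2[where f = "(*)"] sum.cong refl arg_cong[where f = card] arg_cong[where f = real])
      (auto simp: content_Pair)
  finally show ?thesis
    unfolding quad_exp_sum_def by simp
qed

section \<open>Counting pairs with equal sum and nearly equal sum of squares\<close>

text \<open>
  Once the sum is fixed, a pair is determined by its difference, and
  \<open>(k' - l')\<^sup>2 - (k - l)\<^sup>2\<close> is twice the change in the sum of squares. With \<open>d = |k - l|\<close> and
  \<open>d' = |k' - l'|\<close> the condition becomes \<open>|d' - d| (d' + d) \<le> 2 M\<close>, which confines \<open>d'\<close> to within
  \<open>2 M / d\<close> of \<open>d\<close>. For \<open>d = 0\<close> the trivial count \<open>N\<close> suffices, since the diagonal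
  contributes only one \<open>l\<close> for each \<open>k\<close>.
\<close>

lemma card_same_sum_near_sq_sum_le:
  fixes k l N M :: nat
  assumes kl: "k \<in> {1..N}" "l \<in> {1..N}" and M: "M \<le> N"
  shows "real (card {(k', l') \<in> {1..N} \<times> {1..N}. k' + l' = k + l \<and>
            \<bar>int (k'\<^sup>2 + l'\<^sup>2) - int (k\<^sup>2 + l\<^sup>2)\<bar> \<le> int M})
           \<le> 20 * real N / (\<bar>real k - real l\<bar> + 1)"
proof -
  define A where "A = {(k', l') \<in> {1..N} \<times> {1..N}. k' + l' = k + l \<and>
            \<bar>int (k'\<^sup>2 + l'\<^sup>2) - int (k\<^sup>2 + l\<^sup>2)\<bar> \<le> int M}"
  show ?thesis
  proof (cases "k = l")
    case True
    have "card A \<le> card {1..N}"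
      by (rule card_inj_on_le[where f = fst]) (auto simp: A_def inj_on_def)
    then show ?thesis
      using True unfolding A_def[symmetric] by simp
  next
    case False
    define d where "d = \<bar>int k - int l\<bar>"
    have d: "1 \<le> d" "d \<le> int N"
      using False kl by (auto simp: d_def)
    define q where "q = (2 * int M) div d"
    have q0: "0 \<le> q"
      using d by (auto simp: q_def pos_imp_zdiv_nonneg_iff)
    have "card A \<le> card ({d - q..d + q} \<union> {- d - q..- d + q})"
    proof (rule card_inj_on_le[where f = "\<lambda>(k', l'). int k' - int l'"])
      show "inj_on (\<lambda>(k', l'). int k' - int l') A"
        by (auto simp: A_def inj_on_def)
      show "(\<lambda>(k', l'). int k' - int l') ` A \<subseteq> {d - q..d + q} \<union> {- d - q..- d + q}"
      proof clarify
        fix k' l' assume "(k', l') \<in> A" and out: "int k' - int l' \<notin> {- d - q..- d + q}"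
        then have sum: "int k' + int l' = int k + int l"
          and near: "\<bar>int (k'\<^sup>2 + l'\<^sup>2) - int (k\<^sup>2 + l\<^sup>2)\<bar> \<le> int M"
          by (auto simp: A_def)
        define d' where "d' = \<bar>int k' - int l'\<bar>"
        have "(int k' + int l')\<^sup>2 = (int k + int l)\<^sup>2"
          using sum by simp
        then have "(d' - d) * (d' + d) = 2 * (int (k'\<^sup>2 + l'\<^sup>2) - int (k\<^sup>2 + l\<^sup>2))"
          by (simp add: d_def d'_def algebra_simps power2_eq_square flip: abs_mult)
        then have "\<bar>d' - d\<bar> * (d' + d) = 2 * \<bar>int (k'\<^sup>2 + l'\<^sup>2) - int (k\<^sup>2 + l\<^sup>2)\<bar>"
          using d(1) by (metis abs_mult abs_numeral abs_of_nonneg abs_ge_zero add_nonneg_nonneg d'_def d_def)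
        also have "\<dots> \<le> 2 * int M"
          by (rule mult_left_mono[OF near]) simp
        finally have "\<bar>d' - d\<bar> * (d' + d) \<le> 2 * int M" .
        moreover have "\<bar>d' - d\<bar> * d \<le> \<bar>d' - d\<bar> * (d' + d)"
          by (intro mult_left_mono) (auto simp: d'_def)
        ultimately have "\<bar>d' - d\<bar> * d \<le> 2 * int M"
          by linarith
        then have "\<bar>d' - d\<bar> \<le> q"
          using zdiv_mono1[of "\<bar>d' - d\<bar> * d" "2 * int M" d] d(1) by (simp add: q_def)
        then show "int k' - int l' \<in> {d - q..d + q}"
          using out by (auto simp: d'_def abs_if split: if_splits)
      qed
    qed auto
    also have "\<dots> \<le> card {d - q..d + q} + card {- d - q..- d + q}"
      by (rule card_Un_le)
    also have "\<dots> = nat (2 * (2 * q + 1))"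
      using q0 by simp
    finally have "int (card A) \<le> 2 * (2 * q + 1)"
      using q0 by (subst (asm) le_nat_iff) auto
    then have "real_of_int (int (card A)) \<le> real_of_int (2 * (2 * q + 1))"
      by (simp only: of_int_le_iff)
    then have "real (card A) \<le> 2 * (2 * real_of_int q + 1)"
      by simp
    also have "real_of_int q \<le> 2 * real N / real_of_int d"
    proof -
      have "real_of_int q \<le> real_of_int (2 * int M) / real_of_int d"
        unfolding q_def by (rule real_of_int_div4)
      also have "\<dots> \<le> 2 * real N / real_of_int d"
        using M d(1) by (intro divide_right_mono) auto
      finally show ?thesis .
    qed
    finally have "real (card A) \<le> 2 * (2 * (2 * real N / real_of_int d) + 1)"
      by simp
    \<comment> \<open>\<open>d \<le> N\<close> absorbs the additive constant coming from rounding.\<close>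
    also have "\<dots> \<le> 10 * real N / real_of_int d"
      using d by (simp add: field_simps)
    also have "\<dots> \<le> 20 * real N / (real_of_int d + 1)"
      using d by (simp add: field_simps mult_mono)
    finally show ?thesis
      unfolding A_def[symmetric] by (simp add: d_def)
  qed
qed

lemma harm_le_3_ln:
  assumes "2 \<le> N"
  shows "harm N \<le> 3 * ln (real N)"
proof -
  have "harm N - ln (real N) \<le> harm 1 - ln (real 1)"
    using assms by (intro euler_mascheroni_sequence_decreasing) auto
  then have "harm N \<le> 1 + ln (real N)"
    by (simp add: harm_expand)
  moreover have "ln 2 \<le> ln (real N)"
    using assms by simp
  ultimately show ?thesis
    using ln2_ge_two_thirds by linarith
qed

lemma sum_inverse_distance_le:
  assumes "k \<in> {1..N}" "2 \<le> N"
  shows "(\<Sum>l=1..N. 1 / (\<bar>real k - real l\<bar> + 1)) \<le> 6 * ln (real N)"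
proof -
  have "(\<Sum>l=1..N. 1 / (\<bar>real k - real l\<bar> + 1)) \<le>
        (\<Sum>l\<in>{1..k}. 1 / (\<bar>real k - real l\<bar> + 1)) + (\<Sum>l\<in>{k..N}. 1 / (\<bar>real k - real l\<bar> + 1))"
    using assms by (subst sum.union_inter[symmetric]) (auto simp: ivl_disj_un sum_nonneg)
  also have "(\<Sum>l\<in>{1..k}. 1 / (\<bar>real k - real l\<bar> + 1)) = (\<Sum>i<k. inverse (real (Suc i)))"
    by (rule sum.reindex_bij_witness[of _ "\<lambda>i. k - i" "\<lambda>l. k - l"])
       (auto simp: of_nat_diff field_simps)
  also have "\<dots> = harm k"
    by (simp add: harm_altdef)
  also have "(\<Sum>l\<in>{k..N}. 1 / (\<bar>real k - real l\<bar> + 1)) = (\<Sum>i<Suc (N - k). inverse (real (Suc i)))"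
    by (rule sum.reindex_bij_witness[of _ "\<lambda>i. k + i" "\<lambda>l. l - k"])
       (use assms in \<open>auto simp: of_nat_diff field_simps\<close>)
  also have "\<dots> = harm (Suc (N - k))"
    by (simp add: harm_altdef)
  also have "harm k + harm (Suc (N - k)) \<le> harm N + (harm N :: real)"
    using assms by (intro add_mono harm_mono) auto
  finally show ?thesis
    using harm_le_3_ln[OF assms(2)] by linarith
qed

section \<open>The fourth moment on a box of height at most 1/N\<close>

text \<open>
  For \<open>j < M\<close> the hypothesis gives \<open>j y \<le> (M - 1) y \<le> 1/6\<close>, so all phases stay within an angle
  \<open>\<pi>/3\<close> of the positive real axis and there is no cancellation.
\<close>

lemma norm_sum_e_ge:
  assumes "0 \<le> y" "real M * y \<le> 1 / 6 + y"
  shows "real M / 2 \<le> norm (\<Sum>j<M. e (real j * y))"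
proof -
  have "real M / 2 = (\<Sum>j<M. 1 / 2)"
    by simp
  also have "\<dots> \<le> (\<Sum>j<M. Re (e (real j * y)))"
  proof (rule sum_mono)
    fix j assume "j \<in> {..<M}"
    then have "real j + 1 \<le> real M"
      by auto
    then have "(real j + 1) * y \<le> real M * y"
      using assms(1) by (rule mult_right_mono)
    then have "real j * y \<le> 1 / 6"
      using assms(2) by (simp add: algebra_simps)
    then have "2 * pi * (real j * y) \<le> 2 * pi * (1 / 6)"
      by (intro mult_left_mono) auto
    then have "cos (pi / 3) \<le> cos (2 * pi * (real j * y))"
      using assms(1) by (intro cos_monotone_0_pi_le) auto
    then show "1 / 2 \<le> Re (e (real j * y))"
      by (simp add: Re_e cos_60)
  qed
  also have "\<dots> = Re (\<Sum>j<M. e (real j * y))"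
    by simp
  also have "\<dots> \<le> norm (\<Sum>j<M. e (real j * y))"
    by (rule complex_Re_le_cmod)
  finally show ?thesis .
qed

text \<open>
  Schur's test for a symmetric nonnegative kernel.
\<close>

lemma sum_sum_weighted_le:
  fixes b :: "nat \<Rightarrow> real" and w :: "nat \<Rightarrow> nat \<Rightarrow> real"
  assumes "finite S"
    and sym: "\<And>k l. w k l = w l k" and nonneg: "\<And>k l. 0 \<le> w k l"
    and row: "\<And>k. k \<in> S \<Longrightarrow> (\<Sum>l\<in>S. w k l) \<le> W"
  shows "(\<Sum>k\<in>S. \<Sum>l\<in>S. b k * b l * w k l) \<le> W * (\<Sum>k\<in>S. (b k)\<^sup>2)"
proof -
  have "(\<Sum>k\<in>S. \<Sum>l\<in>S. b k * b l * w k l) \<le>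
        (\<Sum>k\<in>S. \<Sum>l\<in>S. ((b k)\<^sup>2 + (b l)\<^sup>2) / 2 * w k l)"
    using sum_squares_bound by (intro sum_mono mult_right_mono nonneg) (simp add: field_simps)
  also have "\<dots> = ((\<Sum>k\<in>S. \<Sum>l\<in>S. (b k)\<^sup>2 * w k l) + (\<Sum>k\<in>S. \<Sum>l\<in>S. (b l)\<^sup>2 * w k l)) / 2"
    by (simp add: sum_divide_distrib flip: sum.distrib) (simp add: field_simps)
  also have "(\<Sum>k\<in>S. \<Sum>l\<in>S. (b l)\<^sup>2 * w k l) = (\<Sum>k\<in>S. \<Sum>l\<in>S. (b k)\<^sup>2 * w k l)"
    by (subst sum.swap) (simp add: sym)
  also have "((\<Sum>k\<in>S. \<Sum>l\<in>S. (b k)\<^sup>2 * w k l) + (\<Sum>k\<in>S. \<Sum>l\<in>S. (b k)\<^sup>2 * w k l)) / 2 =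
             (\<Sum>k\<in>S. (b k)\<^sup>2 * (\<Sum>l\<in>S. w k l))"
    by (simp only: field_sum_of_halves add_divide_distrib sum_distrib_left)
  also have "\<dots> \<le> (\<Sum>k\<in>S. (b k)\<^sup>2 * W)"
    by (intro sum_mono mult_left_mono row) auto
  finally show ?thesis
    by (simp add: sum_distrib_left mult.commute)
qed

text \<open>
  The product of \<open>f\<^sup>2\<close> with a Dirichlet kernel of length \<open>M\<close> is a trigonometric polynomial with
  frequencies \<open>(k + l, k\<^sup>2 + l\<^sup>2 + j)\<close>, \<open>j < M\<close>, on the full torus, where almost orthogonality applies
  in both variables. Two index triples share a frequency only if the pairs \<open>(k, l)\<close> have equal sum
  and sums of squares differing by less than \<open>M\<close>; given the pairs, one \<open>j\<close> determines the other.
  So the multiplicity of a frequency is at most \<open>20 N / (|k - l| + 1)\<close>, and summing this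
  weight over \<open>l\<close> costs a logarithm.
\<close>

lemma mollified_fourth_moment_le:
  assumes N: "2 \<le> N" and M: "M \<le> N"
  shows "integral (cbox (0, 0) (1, 1))
           (\<lambda>x. (norm ((quad_exp_sum N a x)\<^sup>2 * (\<Sum>j<M. e (real j * snd x))))\<^sup>2)
         \<le> 120 * real M * real N * ln (real N) * (\<Sum>k=1..N. norm (a k) ^ 4)"
proof -
  define S where "S = {1..N} \<times> {1..N} \<times> {..<M}"
  define c where "c = (\<lambda>(k, l, j::nat). a k * a l)"
  define \<phi> where "\<phi> = (\<lambda>(k::nat, l, j). (k + l, k\<^sup>2 + l\<^sup>2 + j))"
  define u where "u = (\<lambda>s (x::real \<times> real). e (real (fst (\<phi> s)) * fst x + real (snd (\<phi> s)) * snd x))"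
  have expand: "(quad_exp_sum N a x)\<^sup>2 * (\<Sum>j<M. e (real j * snd x)) = (\<Sum>s\<in>S. c s * u s x)" for x
  proof -
    define X where "X = (\<lambda>k. a k * e (fst x * real k + snd x * (real k)\<^sup>2))"
    have "quad_exp_sum N a x = sum X {1..N}"
      by (simp add: quad_exp_sum_def X_def)
    then have "(quad_exp_sum N a x)\<^sup>2 * (\<Sum>j<M. e (real j * snd x)) =
          (\<Sum>k=1..N. \<Sum>l=1..N. X k * X l) * (\<Sum>j<M. e (real j * snd x))"
      by (simp only: power2_eq_square sum_product[of X "{1..N}" X "{1..N}"])
    also have "\<dots> = (\<Sum>k=1..N. \<Sum>l=1..N. \<Sum>j<M. X k * X l * e (real j * snd x))"
      by (simp only: sum_distrib_right) (simp only: sum_distrib_left)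
    also have "\<dots> = (\<Sum>k=1..N. \<Sum>l=1..N. \<Sum>j<M. c (k, l, j) * u (k, l, j) x)"
    proof (intro sum.cong refl)
      fix k l j
      have "e (fst x * real k + snd x * (real k)\<^sup>2) * e (fst x * real l + snd x * (real l)\<^sup>2) *
              e (real j * snd x) = u (k, l, j) x"
        unfolding e_add[symmetric] u_def \<phi>_def by (simp add: algebra_simps)
      then show "X k * X l * e (real j * snd x) = c (k, l, j) * u (k, l, j) x"
        by (simp add: X_def c_def mult_ac)
    qed
    also have "\<dots> = (\<Sum>s\<in>S. c s * u s x)"
      by (simp add: S_def sum.cartesian_product case_prod_unfold)
    finally show ?thesis .
  qed
  have "integral (cbox (0, 0) (1, 1))
           (\<lambda>x. (norm ((quad_exp_sum N a x)\<^sup>2 * (\<Sum>j<M. e (real j * snd x))))\<^sup>2)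
        = integral (cbox (0, 0) (1, 1)) (\<lambda>x. (norm (\<Sum>s\<in>S. c s * u s x))\<^sup>2)"
    by (simp only: expand)
  also have "\<dots> \<le> measure lborel (cbox (0::real, 0::real) (1, 1)) *
        (\<Sum>s\<in>S. (norm (c s))\<^sup>2 * real (card {t \<in> S. \<phi> t = \<phi> s}))"
  proof (rule integral_norm_sq_sum_le)
    show "finite S"
      by (simp add: S_def)
    show "continuous_on (cbox (0, 0) (1, 1)) (u s)" for s
      unfolding u_def by (intro continuous_intros)
    show "norm (u s x) \<le> 1" for s x
      by (simp add: u_def)
    fix s t assume "\<phi> s \<noteq> \<phi> t"
    define m where "m = int (fst (\<phi> s)) - int (fst (\<phi> t))"
    define n where "n = int (snd (\<phi> s)) - int (snd (\<phi> t))"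
    have "m \<noteq> 0 \<or> n \<noteq> 0"
      using \<open>\<phi> s \<noteq> \<phi> t\<close> by (auto simp: m_def n_def prod_eq_iff)
    moreover have "u s x * cnj (u t x) = e (real_of_int m * fst x + real_of_int n * snd x)" for x
      unfolding u_def cnj_e e_add[symmetric] m_def n_def by (simp add: algebra_simps)
    ultimately show "integral (cbox (0, 0) (1, 1)) (\<lambda>x. u s x * cnj (u t x)) = 0"
      by (auto simp: integral_box_e integral_e_eq_0)
  qed
  also have "\<dots> = (\<Sum>s\<in>S. (norm (c s))\<^sup>2 * real (card {t \<in> S. \<phi> t = \<phi> s}))"
    by (simp add: content_Pair)
  also have "\<dots> \<le> (\<Sum>(k, l, j)\<in>S. (norm (a k))\<^sup>2 * (norm (a l))\<^sup>2 *
                       (20 * real N / (\<bar>real k - real l\<bar> + 1)))"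
  proof (rule sum_mono, clarify)
    fix k l j assume s: "(k, l, j) \<in> S"
    define A where "A = {(k', l') \<in> {1..N} \<times> {1..N}. k' + l' = k + l \<and>
            \<bar>int (k'\<^sup>2 + l'\<^sup>2) - int (k\<^sup>2 + l\<^sup>2)\<bar> \<le> int M}"
    have "card {t \<in> S. \<phi> t = \<phi> (k, l, j)} \<le> card A"
    proof (rule card_inj_on_le[where f = "\<lambda>(k', l', j'). (k', l')"])
      show "inj_on (\<lambda>(k', l', j'). (k', l')) {t \<in> S. \<phi> t = \<phi> (k, l, j)}"
        by (auto simp: inj_on_def \<phi>_def) (metis add_left_cancel add_right_cancel)
      show "(\<lambda>(k', l', j'). (k', l')) ` {t \<in> S. \<phi> t = \<phi> (k, l, j)} \<subseteq> A"
      proof clarify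
        fix k' l' j' assume t: "(k', l', j') \<in> S" and eq: "\<phi> (k', l', j') = \<phi> (k, l, j)"
        then have "k'\<^sup>2 + l'\<^sup>2 + j' = k\<^sup>2 + l\<^sup>2 + j"
          by (simp add: \<phi>_def)
        moreover have "j < M" "j' < M"
          using s t by (auto simp: S_def)
        ultimately have "\<bar>int (k'\<^sup>2 + l'\<^sup>2) - int (k\<^sup>2 + l\<^sup>2)\<bar> \<le> int M"
          by linarith
        then show "(k', l') \<in> A"
          using t eq by (auto simp: A_def S_def \<phi>_def)
      qed
      show "finite A"
        by (rule finite_subset[of _ "{1..N} \<times> {1..N}"]) (auto simp: A_def)
    qed
    also have "real (card A) \<le> 20 * real N / (\<bar>real k - real l\<bar> + 1)"
      unfolding A_def using s M by (intro card_same_sum_near_sq_sum_le) (auto simp: S_def)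
    finally have "real (card {t \<in> S. \<phi> t = \<phi> (k, l, j)}) \<le> 20 * real N / (\<bar>real k - real l\<bar> + 1)"
      by simp
    then show "(norm (c (k, l, j)))\<^sup>2 * real (card {t \<in> S. \<phi> t = \<phi> (k, l, j)}) \<le>
          (norm (a k))\<^sup>2 * (norm (a l))\<^sup>2 * (20 * real N / (\<bar>real k - real l\<bar> + 1))"
      unfolding c_def by (simp only: prod.case norm_mult power_mult_distrib) (intro mult_left_mono, auto)
  qed
  also have "\<dots> = 20 * real M * real N *
      (\<Sum>k=1..N. \<Sum>l=1..N. (norm (a k))\<^sup>2 * (norm (a l))\<^sup>2 * (1 / (\<bar>real k - real l\<bar> + 1)))"
    unfolding S_def sum.cartesian_product[symmetric] sum_distrib_left
    by (simp add: mult_ac)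
  also have "\<dots> \<le> 20 * real M * real N * (6 * ln (real N) * (\<Sum>k=1..N. ((norm (a k))\<^sup>2)\<^sup>2))"
    by (intro mult_left_mono sum_sum_weighted_le sum_inverse_distance_le)
       (use N in \<open>auto simp: abs_minus_commute\<close>)
  finally show ?thesis
    by (simp add: mult_ac flip: power_mult)
qed

text \<open>
  The Dirichlet kernel of length about \<open>N / 6\<close> in \<open>snd x\<close> is at least half its length as long as
  \<open>0 \<le> snd x \<le> 1 / N\<close>. It therefore acts as a majorant of the indicator of the thin box whose
  frequencies are localised to an interval of length about \<open>N\<close>, and the integral may be
  extended to the whole torus.
\<close>

lemma fourth_moment_le:
  assumes N: "2 \<le> N" and h: "h \<le> 1 / real N"
  shows "integral (cbox (0, 0) (1, h)) (\<lambda>x. norm (quad_exp_sum N a x) ^ 4)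
           \<le> 2880 * ln (real N) * (\<Sum>k=1..N. norm (a k) ^ 4)"
proof -
  \<comment> \<open>The ceiling of \<open>N / 6\<close>: then \<open>(M - 1) / N < 1 / 6\<close>, while \<open>M \<ge> N / 6\<close>.\<close>
  define M where "M = (N + 5) div 6"
  have M: "0 < M" "M \<le> N" "real N \<le> 6 * real M" "6 * real M \<le> real N + 5"
    using N by (auto simp: M_def)
  define F where "F = (\<lambda>x. (norm ((quad_exp_sum N a x)\<^sup>2 * (\<Sum>j<M. e (real j * snd x))))\<^sup>2)"
  have contF: "continuous_on T F" for T
    unfolding F_def by (intro continuous_intros)
  have h1: "h \<le> 1"
    using N by (intro order_trans[OF h]) (simp add: field_simps)
  have "integral (cbox (0, 0) (1, h)) (\<lambda>x. norm (quad_exp_sum N a x) ^ 4) \<le>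
        integral (cbox (0, 0) (1, h)) (\<lambda>x. 4 / (real M)\<^sup>2 * F x)"
  proof (rule integral_le)
    show "(\<lambda>x. norm (quad_exp_sum N a x) ^ 4) integrable_on cbox (0, 0) (1, h)"
      by (intro integrable_continuous continuous_intros)
    show "(\<lambda>x. 4 / (real M)\<^sup>2 * F x) integrable_on cbox (0, 0) (1, h)"
      by (intro integrable_continuous continuous_intros contF)
    fix x assume "x \<in> cbox (0::real, 0::real) (1, h)"
    then have x: "0 \<le> snd x" "snd x \<le> 1 / real N"
      using h by (auto simp: cbox_Pair_eq)
    have "(6 * real M) * snd x \<le> (real N + 5) * snd x"
      using M x by (intro mult_right_mono) auto
    moreover have "real N * snd x \<le> 1"
      using x N by (simp add: field_simps)
    ultimately have "real M * snd x \<le> 1 / 6 + snd x"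
      using x by (simp add: algebra_simps)
    with x have "(real M / 2)\<^sup>2 \<le> (norm (\<Sum>j<M. e (real j * snd x)))\<^sup>2"
      by (intro power_mono norm_sum_e_ge) auto
    then have "1 \<le> 4 / (real M)\<^sup>2 * (norm (\<Sum>j<M. e (real j * snd x)))\<^sup>2"
      using M by (simp add: field_simps)
    then have "norm (quad_exp_sum N a x) ^ 4 * 1 \<le> norm (quad_exp_sum N a x) ^ 4 *
         (4 / (real M)\<^sup>2 * (norm (\<Sum>j<M. e (real j * snd x)))\<^sup>2)"
      by (intro mult_left_mono) auto
    also have "\<dots> = 4 / (real M)\<^sup>2 * F x"
      by (simp add: F_def norm_mult norm_power power_mult_distrib flip: power_mult)
    finally show "norm (quad_exp_sum N a x) ^ 4 \<le> 4 / (real M)\<^sup>2 * F x"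
      by simp
  qed
  also have "\<dots> = 4 / (real M)\<^sup>2 * integral (cbox (0, 0) (1, h)) F"
    by (rule Henstock_Kurzweil_Integration.integral_mult_right)
  also have "\<dots> \<le> 4 / (real M)\<^sup>2 * integral (cbox (0, 0) (1, 1)) F"
    using h1 by (intro mult_left_mono integral_subset_le integrable_continuous contF)
      (auto simp: F_def cbox_Pair_eq)
  also have "\<dots> \<le> 4 / (real M)\<^sup>2 *
      (120 * real M * real N * ln (real N) * (\<Sum>k=1..N. norm (a k) ^ 4))"
    unfolding F_def using N M by (intro mult_left_mono mollified_fourth_moment_le) auto
  also have "\<dots> = 480 * (real N / real M) * (ln (real N) * (\<Sum>k=1..N. norm (a k) ^ 4))"
    using M by (simp add: field_simps power2_eq_square)
  also have "\<dots> \<le> 480 * 6 * (ln (real N) * (\<Sum>k=1..N. norm (a k) ^ 4))"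
    using M N by (intro mult_right_mono mult_nonneg_nonneg sum_nonneg) (auto simp: field_simps)
  finally show ?thesis
    by simp
qed

section \<open>Intermediate exponents for coefficients of bounded size\<close>

text \<open>
  For \<open>\<sigma> \<le> 2\<close> this is the larger of \<open>N powr (\<sigma> / 2 * (1 - 4 / p))\<close> and \<open>N powr (1 - 4 / p)\<close>,
  because \<open>1 - 4 / p\<close> changes sign at \<open>p = 4\<close>. A single power, unlike the sum of the two, is
  compatible with taking \<open>p\<close>-th powers and roots.
\<close>

definition dominant_factor :: "real \<Rightarrow> real \<Rightarrow> nat \<Rightarrow> real" where
  "dominant_factor \<sigma> p N = real N powr ((if p \<le> 4 then \<sigma> / 2 else 1) * (1 - 4 / p))"

lemma dominant_factor_powr:
  assumes "0 < p"
  shows "dominant_factor \<sigma> p N powr p = real N powr ((if p \<le> 4 then \<sigma> / 2 else 1) * (p - 4))"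
proof -
  have "(1 - 4 / p) * p = p - 4"
    using assms by (simp add: field_simps)
  then show ?thesis
    by (simp only: dominant_factor_def powr_powr mult.assoc)
qed

text \<open>
  When all nonzero coefficients have size comparable to \<open>A\<close>, the quantity \<open>card T * A powr p\<close> is
  comparable to the \<open>p\<close>-th power of their \<open>\<ell>\<^sup>p\<close> norm, for every \<open>p\<close> at once; this is what lets the
  bounds at \<open>p = 2\<close>, \<open>p = 4\<close> and \<open>p = \<infinity>\<close> be combined pointwise, without an interpolation theorem.
  For \<open>p \<le> 4\<close> one uses \<open>y powr p \<le> lam powr (p - 2) * y\<^sup>2 + lam powr (p - 4) * y ^ 4\<close>, valid for every
  \<open>lam > 0\<close>; for \<open>p > 4\<close> one factors out \<open>(N * A) powr (p - 4)\<close>.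
\<close>

lemma moment_le_of_bounded_coeffs:
  fixes b :: "nat \<Rightarrow> complex"
  assumes \<sigma>: "1 \<le> \<sigma>" and p: "2 \<le> p" and N: "2 \<le> N"
    and T: "T \<subseteq> {1..N}" and A: "0 < A"
    and le: "\<And>k. k \<in> T \<Longrightarrow> norm (b k) \<le> A"
    and zero: "\<And>k. k \<notin> T \<Longrightarrow> b k = 0"
  shows "integral (cbox (0, 0) (1, real N powr - \<sigma>)) (\<lambda>x. norm (quad_exp_sum N b x) powr p)
           \<le> 2882 * ln (real N) * dominant_factor \<sigma> p N powr p * (real (card T) * A powr p)"
proof -
  define h where "h = real N powr - \<sigma>"
  define f where "f = quad_exp_sum N b"
  let ?B = "cbox (0::real, 0::real) (1, h)"
  have h: "0 \<le> h" "h \<le> 1 / real N"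
  proof -
    have "real N powr - \<sigma> \<le> real N powr - 1"
      using N \<sigma> by (intro powr_mono) auto
    then show "h \<le> 1 / real N"
      using N by (simp add: h_def powr_minus_divide)
  qed (simp add: h_def)
  have lnN: "1 \<le> 2 * ln (real N)"
  proof -
    have "ln 2 \<le> ln (real N)"
      using N by simp
    then show ?thesis
      using ln2_ge_two_thirds by linarith
  qed
  have fin: "finite T"
    using T finite_subset by blast
  have sum_power: "(\<Sum>k=1..N. norm (b k) ^ n) \<le> real (card T) * A ^ n" if "0 < n" for n
  proof -
    have "(\<Sum>k=1..N. norm (b k) ^ n) = (\<Sum>k\<in>T. norm (b k) ^ n)"
      using T that zero by (intro sum.mono_neutral_right) auto
    also have "\<dots> \<le> (\<Sum>k\<in>T. A ^ n)"
      by (intro sum_mono power_mono le) auto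
    finally show ?thesis
      by simp
  qed
  have contf: "continuous_on S f" for S
    unfolding f_def by (intro continuous_intros)
  have int_powr: "(\<lambda>x. norm (f x) powr p) integrable_on ?B"
    using p by (intro integrable_continuous continuous_on_powr' continuous_intros contf) auto
  have int: "(\<lambda>x. c * norm (f x) ^ n) integrable_on ?B" for c n
    by (intro integrable_continuous continuous_intros contf)
  have I2: "integral ?B (\<lambda>x. norm (f x) ^ 2) \<le> h * (real (card T) * A ^ 2)"
  proof -
    have "integral ?B (\<lambda>x. norm (f x) ^ 2) \<le> h * (\<Sum>k=1..N. (norm (b k))\<^sup>2)"
      unfolding f_def by (rule second_moment_le[OF h(1)])
    also have "\<dots> \<le> h * (real (card T) * A ^ 2)"
      by (intro mult_left_mono sum_power h) simp
    finally show ?thesis .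
  qed
  have I4: "integral ?B (\<lambda>x. norm (f x) ^ 4) \<le> 2880 * ln (real N) * (real (card T) * A ^ 4)"
  proof -
    have "integral ?B (\<lambda>x. norm (f x) ^ 4) \<le> 2880 * ln (real N) * (\<Sum>k=1..N. norm (b k) ^ 4)"
      unfolding f_def by (rule fourth_moment_le[OF N h(2)])
    also have "\<dots> \<le> 2880 * ln (real N) * (real (card T) * A ^ 4)"
      by (intro mult_left_mono sum_power) (use lnN in auto)
    finally show ?thesis .
  qed
  have N0: "0 < real N"
    using N by simp
  show ?thesis
  proof (cases "p \<le> 4")
    case True
    \<comment> \<open>This height balances the second-moment term \<open>lam powr (p - 2) * h * A\<^sup>2\<close> against the
      fourth-moment term \<open>lam powr (p - 4) * A ^ 4\<close>: both are equal when \<open>lam\<^sup>2 = A\<^sup>2 / h\<close>.\<close>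
    define lam where "lam = A * real N powr (\<sigma> / 2)"
    have lam: "0 < lam"
      using A N by (simp add: lam_def)
    have split: "y powr p \<le> lam powr (p - 2) * y ^ 2 + lam powr (p - 4) * y ^ 4" if "0 \<le> y" for y
    proof (cases "y = 0")
      case False
      with that have y: "0 < y"
        by simp
      show ?thesis
      proof (cases "y \<le> lam")
        case True
        have "y powr p = y powr (p - 2) * y ^ 2"
          using y by (simp add: powr_diff)
        also have "\<dots> \<le> lam powr (p - 2) * y ^ 2"
          using True y p by (intro mult_right_mono powr_mono2) auto
        finally show ?thesis
          using y by (simp add: add_increasing2)
      next
        case False
        have "y powr p = y powr (p - 4) * y ^ 4"
          using y by (simp add: powr_diff)
        also have "\<dots> \<le> lam powr (p - 4) * y ^ 4"
          using False y lam \<open>p \<le> 4\<close> by (intro mult_right_mono powr_mono2') auto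
        finally show ?thesis
          using y by (simp add: add_increasing)
      qed
    qed (use p in simp)
    have "integral ?B (\<lambda>x. norm (f x) powr p) \<le>
          integral ?B (\<lambda>x. lam powr (p - 2) * norm (f x) ^ 2 + lam powr (p - 4) * norm (f x) ^ 4)"
      by (intro integral_le int_powr integrable_add int split) simp
    also have "\<dots> = lam powr (p - 2) * integral ?B (\<lambda>x. norm (f x) ^ 2) +
                    lam powr (p - 4) * integral ?B (\<lambda>x. norm (f x) ^ 4)"
      by (subst Henstock_Kurzweil_Integration.integral_add[OF int int])
         (simp only: Henstock_Kurzweil_Integration.integral_mult_right)
    also have "\<dots> \<le> lam powr (p - 2) * (h * (real (card T) * A ^ 2)) +
                    lam powr (p - 4) * (2880 * ln (real N) * (real (card T) * A ^ 4))"
      by (intro add_mono mult_left_mono I2 I4) auto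
    also have "\<dots> = real (card T) * ((lam powr (p - 2) * h * A ^ 2) +
                         2880 * ln (real N) * (lam powr (p - 4) * A ^ 4))"
      by (simp add: algebra_simps)
    also have "lam powr (p - 2) * h * A ^ 2 = real N powr (\<sigma> / 2 * (p - 4)) * A powr p"
    proof -
      have "lam powr (p - 2) * h * A ^ 2 =
            A powr (p - 2) * A powr 2 * (real N powr (\<sigma> / 2 * (p - 2)) * real N powr (- \<sigma>))"
        using A N by (simp add: lam_def h_def powr_mult powr_powr)
      also have "\<dots> = A powr (p - 2 + 2) * real N powr (\<sigma> / 2 * (p - 2) + - \<sigma>)"
        by (simp only: powr_add)
      also have "\<dots> = real N powr (\<sigma> / 2 * (p - 4)) * A powr p"
        by (simp add: field_simps)
      finally show ?thesis .
    qed
    also have "lam powr (p - 4) * A ^ 4 = real N powr (\<sigma> / 2 * (p - 4)) * A powr p"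
    proof -
      have "lam powr (p - 4) * A ^ 4 = A powr (p - 4) * A powr 4 * real N powr (\<sigma> / 2 * (p - 4))"
        using A N by (simp add: lam_def powr_mult powr_powr)
      also have "\<dots> = A powr (p - 4 + 4) * real N powr (\<sigma> / 2 * (p - 4))"
        by (simp only: powr_add)
      also have "\<dots> = real N powr (\<sigma> / 2 * (p - 4)) * A powr p"
        by simp
      finally show ?thesis .
    qed
    also have "real (card T) * (real N powr (\<sigma> / 2 * (p - 4)) * A powr p +
                  2880 * ln (real N) * (real N powr (\<sigma> / 2 * (p - 4)) * A powr p)) =
               (1 + 2880 * ln (real N)) * (real N powr (\<sigma> / 2 * (p - 4)) * (real (card T) * A powr p))"
      by (simp add: algebra_simps)
    also have "\<dots> \<le> (2882 * ln (real N)) * (real N powr (\<sigma> / 2 * (p - 4)) * (real (card T) * A powr p))"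
      using lnN by (intro mult_right_mono) auto
    finally show ?thesis
      using True p by (simp add: dominant_factor_powr f_def h_def mult_ac)
  next
    case False
    have sup: "norm (f x) \<le> real N * A" for x
    proof -
      have "norm (f x) \<le> (\<Sum>k=1..N. A)"
        unfolding f_def quad_exp_sum_def
      proof (rule sum_norm_le)
        fix k
        show "norm (b k * e (fst x * real k + snd x * (real k)\<^sup>2)) \<le> A"
          using le[of k] zero[of k] A by (cases "k \<in> T") (auto simp: norm_mult)
      qed
      then show ?thesis
        by simp
    qed
    have "integral ?B (\<lambda>x. norm (f x) powr p) \<le>
          integral ?B (\<lambda>x. (real N * A) powr (p - 4) * norm (f x) ^ 4)"
    proof (intro integral_le int_powr int)
      fix x
      show "norm (f x) powr p \<le> (real N * A) powr (p - 4) * norm (f x) ^ 4"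
      proof (cases "norm (f x) = 0")
        case False
        then have "norm (f x) powr p = norm (f x) powr (p - 4) * norm (f x) ^ 4"
          by (simp add: powr_diff)
        also have "\<dots> \<le> (real N * A) powr (p - 4) * norm (f x) ^ 4"
          using sup \<open>\<not> p \<le> 4\<close> by (intro mult_right_mono powr_mono2) auto
        finally show ?thesis .
      qed (use p in simp)
    qed
    also have "\<dots> = (real N * A) powr (p - 4) * integral ?B (\<lambda>x. norm (f x) ^ 4)"
      by (rule Henstock_Kurzweil_Integration.integral_mult_right)
    also have "\<dots> \<le> (real N * A) powr (p - 4) * (2880 * ln (real N) * (real (card T) * A ^ 4))"
      by (intro mult_left_mono I4) auto
    also have "\<dots> = 2880 * ln (real N) * (real N powr (p - 4) * (real (card T) * (A powr (p - 4) * A powr 4)))"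
      using A N by (simp add: powr_mult)
    also have "A powr (p - 4) * A powr 4 = A powr p"
      by (simp only: powr_add[symmetric]) simp
    also have "2880 * ln (real N) * (real N powr (p - 4) * (real (card T) * A powr p)) \<le>
               2882 * ln (real N) * (real N powr (p - 4) * (real (card T) * A powr p))"
      using lnN by (intro mult_right_mono) auto
    finally show ?thesis
      using False p by (simp add: dominant_factor_powr f_def h_def mult_ac)
  qed
qed

section \<open>Decomposition into dyadic level sets\<close>

text \<open>
  The sum is at most \<open>card S\<close> times its largest term. In the application \<open>card S\<close> is \<open>O(ln N)\<close>, so
  this loss is only logarithmic after taking \<open>p\<close>-th roots.
\<close>

lemma norm_sum_powr_le:
  fixes g :: "'s \<Rightarrow> complex"
  assumes "finite S" "S \<noteq> {}" "0 < p"
  shows "norm (\<Sum>s\<in>S. g s) powr p \<le> real (card S) powr p * (\<Sum>s\<in>S. norm (g s) powr p)"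
proof -
  define m where "m = Max ((\<lambda>s. norm (g s)) ` S)"
  have "m \<in> (\<lambda>s. norm (g s)) ` S"
    unfolding m_def using assms by (intro Max_in) auto
  then obtain t where t: "t \<in> S" "m = norm (g t)"
    by blast
  have "norm (\<Sum>s\<in>S. g s) \<le> (\<Sum>s\<in>S. m)"
    unfolding m_def using assms by (intro sum_norm_le) auto
  then have "norm (\<Sum>s\<in>S. g s) powr p \<le> (real (card S) * m) powr p"
    using assms by (intro powr_mono2) auto
  also have "\<dots> = real (card S) powr p * m powr p"
    using t by (simp add: powr_mult)
  also have "m powr p \<le> (\<Sum>s\<in>S. norm (g s) powr p)"
    unfolding t(2) using assms t by (intro member_le_sum) auto
  finally show ?thesis
    by (simp add: mult_left_mono)
qed

text \<open>
  Level \<open>j < J\<close> holds the coefficients whose size lies within a factor 2 below \<open>A j\<close>, so each of its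
  members pays for its own \<open>A j powr p\<close>. The last level collects everything of size at most
  \<open>max |a| / 2 ^ J \<le> max |a| / N\<close>: it may contain as many as \<open>N\<close> indices, but together they cost no more
  than the single largest coefficient. This is why logarithmically many levels suffice.
\<close>

lemma dyadic_level_sets:
  fixes a :: "nat \<Rightarrow> complex"
  assumes N: "2 \<le> N" and p: "2 \<le> p" and ne: "\<exists>k\<in>{1..N}. a k \<noteq> 0"
  shows "\<exists>(J :: nat) (\<iota> :: nat \<Rightarrow> nat) (A :: nat \<Rightarrow> real).
           real (Suc J) \<le> 6 * ln (real N) \<and> (\<forall>k. \<iota> k \<le> J) \<and> (\<forall>j. 0 < A j) \<and>
           (\<forall>k\<in>{1..N}. norm (a k) \<le> A (\<iota> k)) \<and>
           (\<forall>j\<le>J. real (card {k \<in> {1..N}. \<iota> k = j}) * A j powr p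
                    \<le> 2 powr p * (\<Sum>k=1..N. norm (a k) powr p))"
proof -
  define m where "m = Max ((\<lambda>k. norm (a k)) ` {1..N})"
  define S where "S = (\<Sum>k=1..N. norm (a k) powr p)"
  define A where "A = (\<lambda>j::nat. m / 2 ^ j)"
  define J where "J = nat \<lceil>log 2 (real N)\<rceil>"
  \<comment> \<open>The disjunct \<open>j = J\<close> sends all remaining small coefficients, including zeros, to the last level.\<close>
  define \<iota> where "\<iota> = (\<lambda>k. LEAST j. j = J \<or> A (Suc j) < norm (a k))"
  have le_m: "norm (a k) \<le> m" if "k \<in> {1..N}" for k
    unfolding m_def using that by (intro Max_ge) auto
  have m: "0 < m"
    using ne le_m by (metis norm_le_zero_iff not_le order_trans)
  have "m \<in> (\<lambda>k. norm (a k)) ` {1..N}"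
    unfolding m_def using N by (intro Max_in) auto
  then have mS: "m powr p \<le> S"
    unfolding S_def by (auto intro!: member_le_sum[where f = "\<lambda>k. norm (a k) powr p"])
  have log: "1 \<le> log 2 (real N)"
    using N by simp
  have NJ: "real N \<le> 2 ^ J"
  proof -
    have "real N = 2 powr log 2 (real N)"
      using N by simp
    also have "\<dots> \<le> 2 powr real J"
      using log by (intro powr_mono) (auto simp: J_def)
    finally show ?thesis
      by (simp add: powr_realpow)
  qed
  have \<iota>: "\<iota> k = J \<or> A (Suc (\<iota> k)) < norm (a k)" for k
    unfolding \<iota>_def by (rule LeastI[of _ J]) simp
  show ?thesis
  proof (intro exI conjI allI ballI impI)
    have "real J \<le> log 2 (real N) + 1"
      using log unfolding J_def by linarith
    then have "real (Suc J) \<le> 3 * log 2 (real N)"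
      using log by simp
    also have "\<dots> = 3 * ln (real N) / ln 2"
      by (simp add: log_def)
    also have "\<dots> \<le> 6 * ln (real N)"
    proof -
      have "3 * ln (real N) * 1 \<le> 3 * ln (real N) * (2 * ln 2)"
        using ln2_ge_two_thirds N by (intro mult_left_mono) auto
      then show ?thesis
        by (simp add: field_simps)
    qed
    finally show "real (Suc J) \<le> 6 * ln (real N)" .
    show "\<iota> k \<le> J" for k
      unfolding \<iota>_def by (rule Least_le) simp
    show "0 < A j" for j
      using m by (simp add: A_def)
    show "norm (a k) \<le> A (\<iota> k)" if "k \<in> {1..N}" for k
    proof (cases "\<iota> k")
      case 0
      then show ?thesis
        using le_m[OF that] by (simp add: A_def)
    next
      case (Suc i)
      then have "\<not> (i = J \<or> A (Suc i) < norm (a k))"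
        unfolding \<iota>_def by (intro not_less_Least) simp
      then show ?thesis
        using Suc by simp
    qed
    fix j assume "j \<le> J"
    define T where "T = {k \<in> {1..N}. \<iota> k = j}"
    have T: "finite T" "T \<subseteq> {1..N}"
      by (auto simp: T_def)
    have two: "1 \<le> 2 powr p"
      using p by (intro ge_one_powr_ge_zero) auto
    have "real (card T) * A j powr p \<le> 2 powr p * S"
    proof (cases "j = J")
      case True
      have "A J powr p \<le> m powr p / real N"
      proof -
        have "A J powr p = m powr p / (2 ^ J) powr p"
          using m by (simp add: A_def powr_divide)
        also have "\<dots> \<le> m powr p / (2 ^ J) powr 1"
          using p by (intro divide_left_mono powr_mono) auto
        also have "\<dots> \<le> m powr p / real N"
          using NJ N by (intro divide_left_mono) auto
        finally show ?thesis .
      qed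
      moreover have "real (card T) \<le> real N"
        using card_mono[OF _ T(2)] by simp
      ultimately have "real (card T) * A j powr p \<le> real N * (m powr p / real N)"
        unfolding True by (intro mult_mono) auto
      also have "\<dots> = m powr p"
        using N by simp
      also have "\<dots> \<le> 1 * S"
        using mS by simp
      also have "\<dots> \<le> 2 powr p * S"
        using two by (intro mult_right_mono) (auto simp: S_def sum_nonneg)
      finally show ?thesis .
    next
      case False
      have "real (card T) * A j powr p = (\<Sum>k\<in>T. A j powr p)"
        by simp
      also have "\<dots> \<le> (\<Sum>k\<in>T. 2 powr p * norm (a k) powr p)"
      proof (rule sum_mono)
        fix k assume "k \<in> T"
        then have "A (Suc j) < norm (a k)"
          using \<iota>[of k] False by (auto simp: T_def)
        then have "A j \<le> 2 * norm (a k)"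
          by (simp add: A_def)
        then have "A j powr p \<le> (2 * norm (a k)) powr p"
          using p m by (intro powr_mono2) (auto simp: A_def)
        then show "A j powr p \<le> 2 powr p * norm (a k) powr p"
          by (simp add: powr_mult)
      qed
      also have "\<dots> \<le> (\<Sum>k=1..N. 2 powr p * norm (a k) powr p)"
        using T by (intro sum_mono2) auto
      finally show ?thesis
        by (simp add: S_def sum_distrib_left)
    qed
    then show "real (card {k \<in> {1..N}. \<iota> k = j}) * A j powr p
                \<le> 2 powr p * (\<Sum>k=1..N. norm (a k) powr p)"
      by (simp add: T_def S_def)
  qed
qed

text \<open>
  The factor \<open>6 ln N\<close> bounds the number of levels. It appears once inside the \<open>p\<close>-th power, from
  splitting the exponential sum, and once outside, from adding up the level contributions.
\<close>

lemma small_cap_moment_le: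
  fixes a :: "nat \<Rightarrow> complex"
  assumes \<sigma>: "1 \<le> \<sigma>" and p: "2 \<le> p" and N: "2 \<le> N" and ne: "\<exists>k\<in>{1..N}. a k \<noteq> 0"
  shows "integral (cbox (0, 0) (1, real N powr - \<sigma>)) (\<lambda>x. norm (quad_exp_sum N a x) powr p)
           \<le> 6 * ln (real N) * (2882 * ln (real N)) *
              (6 * ln (real N) * dominant_factor \<sigma> p N * 2) powr p * (\<Sum>k=1..N. norm (a k) powr p)"
proof -
  let ?B = "cbox (0::real, 0::real) (1, real N powr - \<sigma>)"
  define S where "S = (\<Sum>k=1..N. norm (a k) powr p)"
  have S: "0 \<le> S"
    by (simp add: S_def sum_nonneg)
  have ln: "0 \<le> ln (real N)"
    using N by simp
  obtain J \<iota> A where L: "real (Suc J) \<le> 6 * ln (real N)"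
    and \<iota>: "\<And>k. \<iota> k \<le> J" and A: "\<And>j. 0 < A j"
    and le: "\<And>k. k \<in> {1..N} \<Longrightarrow> norm (a k) \<le> A (\<iota> k)"
    and card: "\<And>j. j \<le> J \<Longrightarrow> real (card {k \<in> {1..N}. \<iota> k = j}) * A j powr p \<le> 2 powr p * S"
    using dyadic_level_sets[OF N p ne] unfolding S_def by blast
  define b where "b = (\<lambda>j k. if k \<in> {1..N} \<and> \<iota> k = j then a k else 0)"
  have decomp: "quad_exp_sum N a x = (\<Sum>j\<le>J. quad_exp_sum N (b j) x)" for x
  proof -
    have "(\<Sum>j\<le>J. quad_exp_sum N (b j) x) =
          (\<Sum>k=1..N. \<Sum>j\<le>J. b j k * e (fst x * real k + snd x * (real k)\<^sup>2))"
      unfolding quad_exp_sum_def by (rule sum.swap)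
    also have "\<dots> = quad_exp_sum N a x"
      unfolding quad_exp_sum_def
    proof (rule sum.cong[OF refl])
      fix k assume k: "k \<in> {1..N}"
      have "(\<Sum>j\<le>J. b j k * e (fst x * real k + snd x * (real k)\<^sup>2)) =
            (\<Sum>j\<le>J. if j = \<iota> k then a k * e (fst x * real k + snd x * (real k)\<^sup>2) else 0)"
        using k by (intro sum.cong) (auto simp: b_def)
      then show "(\<Sum>j\<le>J. b j k * e (fst x * real k + snd x * (real k)\<^sup>2)) =
            a k * e (fst x * real k + snd x * (real k)\<^sup>2)"
        using \<iota>[of k] by simp
    qed
    finally show ?thesis ..
  qed
  have int: "(\<lambda>x. norm (quad_exp_sum N c x) powr p) integrable_on ?B" for c
    using p by (intro integrable_continuous continuous_on_powr' continuous_intros) auto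
  have "integral ?B (\<lambda>x. norm (quad_exp_sum N a x) powr p) \<le>
        integral ?B (\<lambda>x. real (Suc J) powr p * (\<Sum>j\<le>J. norm (quad_exp_sum N (b j) x) powr p))"
  proof (rule integral_le[OF int])
    show "(\<lambda>x. real (Suc J) powr p * (\<Sum>j\<le>J. norm (quad_exp_sum N (b j) x) powr p)) integrable_on ?B"
      by (intro integrable_on_mult_right Henstock_Kurzweil_Integration.integrable_sum int) simp
    show "norm (quad_exp_sum N a x) powr p \<le>
          real (Suc J) powr p * (\<Sum>j\<le>J. norm (quad_exp_sum N (b j) x) powr p)" for x
      unfolding decomp using norm_sum_powr_le[of "{..J}" p "\<lambda>j. quad_exp_sum N (b j) x"] p by simp
  qed
  also have "\<dots> = real (Suc J) powr p *
                 (\<Sum>j\<le>J. integral ?B (\<lambda>x. norm (quad_exp_sum N (b j) x) powr p))"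
    by (simp only: Henstock_Kurzweil_Integration.integral_mult_right
         Henstock_Kurzweil_Integration.integral_sum[OF finite_atMost int])
  also have "\<dots> \<le> real (Suc J) powr p *
        (\<Sum>j\<le>J. 2882 * ln (real N) * dominant_factor \<sigma> p N powr p * (2 powr p * S))"
  proof (intro mult_left_mono sum_mono)
    fix j assume j: "j \<in> {..J}"
    have "integral ?B (\<lambda>x. norm (quad_exp_sum N (b j) x) powr p) \<le>
          2882 * ln (real N) * dominant_factor \<sigma> p N powr p *
            (real (card {k \<in> {1..N}. \<iota> k = j}) * A j powr p)"
      by (rule moment_le_of_bounded_coeffs[OF \<sigma> p N _ A]) (use le in \<open>auto simp: b_def\<close>)
    also have "\<dots> \<le> 2882 * ln (real N) * dominant_factor \<sigma> p N powr p * (2 powr p * S)"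
      using j ln by (intro mult_left_mono card) auto
    finally show "integral ?B (\<lambda>x. norm (quad_exp_sum N (b j) x) powr p) \<le>
          2882 * ln (real N) * dominant_factor \<sigma> p N powr p * (2 powr p * S)" .
  qed simp
  also have "\<dots> = real (Suc J) powr p * real (Suc J) *
        (2882 * ln (real N) * dominant_factor \<sigma> p N powr p * (2 powr p * S))"
    by simp
  also have "\<dots> \<le> (6 * ln (real N)) powr p * (6 * ln (real N)) *
        (2882 * ln (real N) * dominant_factor \<sigma> p N powr p * (2 powr p * S))"
    using L p ln S by (intro mult_right_mono mult_mono powr_mono2 mult_nonneg_nonneg) auto
  also have "\<dots> = 6 * ln (real N) * (2882 * ln (real N)) *
              (6 * ln (real N) * dominant_factor \<sigma> p N * 2) powr p * S"
    by (simp only: powr_mult mult_ac)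
  finally show ?thesis
    unfolding S_def .
qed

lemma LINT_box_eq_integral:
  fixes f :: "real \<times> real \<Rightarrow> real"
  assumes "continuous_on ({0..1} \<times> {0..h}) f"
  shows "(LINT x : {0..1} \<times> {0..h} | lborel. f x) = integral (cbox (0, 0) (1, h)) f"
proof -
  have "set_integrable lborel ({0..1} \<times> {0..h}) f"
    unfolding set_integrable_def
    by (intro borel_integrable_compact compact_Times compact_Icc assms)
  then show ?thesis
    by (simp add: set_borel_integral_eq_integral(2) cbox_Pair_eq)
qed

theorem corollary1p3:
  shows "\<exists>c C :: real. c > 0 \<and> C > 0 \<and>
    (\<forall>(\<sigma>::real) (p::real) (N::nat) (a :: nat \<Rightarrow> complex).
      1 \<le> \<sigma> \<longrightarrow> \<sigma> \<le> 2 \<longrightarrow> 2 \<le> p \<longrightarrow> 2 \<le> N \<longrightarrow>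
      (LINT x : {0..1} \<times> {0..real N powr (- \<sigma>)} | lborel. norm (quad_exp_sum N a x) powr p)
          powr (1 / p)
        \<le> C * (ln (real N)) powr c
            * (real N powr (\<sigma> / 2 * (1 - 4 / p)) + real N powr (1 - 4 / p))
            * (\<Sum>k=1..N. norm (a k) powr p) powr (1 / p))"
\<comment> \<open>One logarithm comes from the fourth moment and two from the number of levels;
  \<open>207504 = (6 * 2882) * (6 * 2)\<close>.\<close>
proof (rule exI[of _ 3], rule exI[of _ 207504], intro conjI allI impI)
  fix \<sigma> p :: real and N :: nat and a :: "nat \<Rightarrow> complex"
  assume \<sigma>: "1 \<le> \<sigma>" and p: "2 \<le> p" and N: "2 \<le> N"
  define I where "I = (LINT x : {0..1} \<times> {0..real N powr (- \<sigma>)} | lborel. norm (quad_exp_sum N a x) powr p)"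
  define S where "S = (\<Sum>k=1..N. norm (a k) powr p)"
  define X where "X = real N powr (\<sigma> / 2 * (1 - 4 / p)) + real N powr (1 - 4 / p)"
  define L where "L = ln (real N)"
  have I: "I = integral (cbox (0, 0) (1, real N powr - \<sigma>)) (\<lambda>x. norm (quad_exp_sum N a x) powr p)"
    unfolding I_def using p
    by (intro LINT_box_eq_integral continuous_on_powr' continuous_intros) auto
  have S: "0 \<le> S"
    by (simp add: S_def sum_nonneg)
  have L: "1 \<le> 2 * L"
  proof -
    have "ln 2 \<le> L"
      using N by (simp add: L_def)
    then show ?thesis
      using ln2_ge_two_thirds by linarith
  qed
  have dom: "0 \<le> dominant_factor \<sigma> p N" "dominant_factor \<sigma> p N \<le> X"
    by (auto simp: dominant_factor_def X_def)
  have "I powr (1 / p) \<le> 207504 * L powr 3 * X * S powr (1 / p)"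
  proof (cases "\<exists>k\<in>{1..N}. a k \<noteq> 0")
    case False
    then have "quad_exp_sum N a x = 0" for x
      by (simp add: quad_exp_sum_def)
    then have "I = 0"
      by (simp add: I)
    then show ?thesis
      using L dom p by simp
  next
    case True
    define K where "K = 6 * L * (2882 * L)"
    have "1 * 1 \<le> 6 * L * (2882 * L)"
      using L by (intro mult_mono) auto
    then have K: "1 \<le> K"
      by (simp add: K_def)
    have "0 \<le> I"
      unfolding I using p
      by (intro integral_nonneg integrable_continuous continuous_on_powr' continuous_intros) auto
    moreover have "I \<le> K * (6 * L * dominant_factor \<sigma> p N * 2) powr p * S"
      using small_cap_moment_le[OF \<sigma> p N True] by (simp add: I K_def L_def S_def)
    ultimately have "I powr (1 / p) \<le> (K * (6 * L * dominant_factor \<sigma> p N * 2) powr p * S) powr (1 / p)"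
      using p by (intro powr_mono2) auto
    also have "\<dots> = K powr (1 / p) * (6 * L * dominant_factor \<sigma> p N * 2) * S powr (1 / p)"
      using K L S dom p by (simp add: powr_mult powr_powr)
    \<comment> \<open>As \<open>K \<ge> 1\<close>, its \<open>p\<close>-th root is at most \<open>K\<close>, which keeps the exponent of the logarithm independent of \<open>p\<close>.\<close>
    also have "\<dots> \<le> K powr 1 * (6 * L * X * 2) * S powr (1 / p)"
      using K L S dom p
      by (intro mult_right_mono mult_mono powr_mono mult_nonneg_nonneg mult_left_mono) auto
    also have "\<dots> = 207504 * L powr 3 * X * S powr (1 / p)"
      using K L by (simp add: K_def power3_eq_cube)
    finally show ?thesis .
  qed
  then show "(LINT x : {0..1} \<times> {0..real N powr (- \<sigma>)} | lborel. norm (quad_exp_sum N a x) powr p)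
          powr (1 / p)
        \<le> 207504 * (ln (real N)) powr 3
            * (real N powr (\<sigma> / 2 * (1 - 4 / p)) + real N powr (1 - 4 / p))
            * (\<Sum>k=1..N. norm (a k) powr p) powr (1 / p)"
    by (simp only: I_def S_def X_def L_def)
qed simp_all

end
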